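(* Let $\varphi$ be a parabolic automorphism of the open unit disk $\mathbb{D}$. Then: (i) every orbit of $\varphi$ is Blaschke summable, that is, $\sum_{m\ge 0}\bigl(1-|\varphi_m(z)|\bigr)<\infty$ for every $z\in\mathbb{D}$; and (ii) for each $z\in\mathbb{D}$, the subspace $B_zH^2$ is invariant under $C_\varphi$, that is, $C_\varphi(B_zH^2)\subseteq B_zH^2$, where $B_z$ is the Blaschke product corresponding to the orbit $\{\varphi_m(z)\}_{m\ge 0}$.
   Context: An automorphism of $\mathbb{D}$ is a bijective holomorphic map $\mathbb{D}\to\mathbb{D}$ (it extends continuously to $\overline{\mathbb{D}}$). It is parabolic if it has only one fixed point in $\partial\mathbb{D}$. For $m\ge 0$, $\varphi_m$ denotes the composition of $\varphi$ with itself $m$ times ($\varphi_0$ is the identity). $H^2$ is the Hardy space of holomorphic functions on $\mathbb{D}$ with $\sup_{0\le r<1}\frac{1}{2\pi}\int_0^{2\pi}|f(re^{it})|^2\,dt<\infty$, and $C_\varphi f=f\circ\varphi$ for $f\in H^2$. The Blaschke product corresponding to a sequence $\{a_m\}_{m\ge0}$ in $\mathbb{D}$ with $\sum(1-|a_m|)<\infty$ is $\prod_{m}\frac{|a_m|}{a_m}\frac{a_m-z}{1-\overline{a_m}z}$, where the factor for $a_m=0$ is understood to be $z$. $BH^2=\{Bh:h\in H^2\}$. *)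

theory Defs
  imports "HOL-Complex_Analysis.Complex_Analysis"
begin

text \<open>
  The open unit disc is \<open>ball 0 1\<close>. Functions on the disc are represented by total functions
  \<open>complex \<Rightarrow> complex\<close>; their values outside the disc are irrelevant, and equalities between
  them are only required on the disc.
\<close>

definition disc_automorphism :: "(complex \<Rightarrow> complex) \<Rightarrow> bool" where
  "disc_automorphism \<phi> \<longleftrightarrow> \<phi> holomorphic_on ball 0 1 \<and> bij_betw \<phi> (ball 0 1) (ball 0 1)"

text \<open>
  Boundary fixed points are those of the continuous extension \<open>\<psi>\<close> of \<open>\<phi>\<close> to the closed disc.
  As the open disc is dense in the closed one, \<open>\<psi>\<close> is uniquely determined there by \<open>\<phi>\<close>.
\<close>

definition parabolic_automorphism :: "(complex \<Rightarrow> complex) \<Rightarrow> bool" where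
  "parabolic_automorphism \<phi> \<longleftrightarrow>
     disc_automorphism \<phi> \<and>
     (\<exists>\<psi>. continuous_on (cball 0 1) \<psi> \<and> (\<forall>z\<in>ball 0 1. \<psi> z = \<phi> z) \<and>
          (\<exists>!w. w \<in> sphere 0 1 \<and> \<psi> w = w))"

definition Hardy2 :: "(complex \<Rightarrow> complex) set" where
  "Hardy2 = {f. f holomorphic_on ball 0 1 \<and>
     bdd_above ((\<lambda>r::real. 1 / (2 * pi) *
        integral {0..2 * pi} (\<lambda>t. (norm (f (of_real r * exp (\<i> * of_real t))))\<^sup>2)) ` {0..<1})}"

definition composition_operator ::
    "(complex \<Rightarrow> complex) \<Rightarrow> (complex \<Rightarrow> complex) \<Rightarrow> (complex \<Rightarrow> complex)" where
  "composition_operator \<phi> f = f \<circ> \<phi>"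

definition blaschke_factor :: "complex \<Rightarrow> complex \<Rightarrow> complex" where
  "blaschke_factor a z =
     (if a = 0 then z else of_real (norm a) / a * ((a - z) / (1 - cnj a * z)))"

text \<open>
  The infinite product is meaningful when \<open>\<Sum>m. 1 - norm (a m)\<close> converges. The
  library's \<open>prodinf\<close> allows finitely many zero factors, the value being \<open>0\<close> in that case.
\<close>

definition blaschke_product :: "(nat \<Rightarrow> complex) \<Rightarrow> complex \<Rightarrow> complex" where
  "blaschke_product a z = (\<Prod>m. blaschke_factor (a m) z)"

text \<open>The space \<open>B H\<^sup>2\<close>, again up to the values outside the disc.\<close>

definition times_Hardy2 :: "(complex \<Rightarrow> complex) \<Rightarrow> (complex \<Rightarrow> complex) set" where
  "times_Hardy2 B = {f. \<exists>h\<in>Hardy2. \<forall>z\<in>ball 0 1. f z = B z * h z}"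

end

theory Submission
  imports Defs
begin

text \<open>
  Summability. By the Schwarz lemma a disc automorphism is a Moebius map
  \<open>z \<mapsto> c (z - a) / (1 - cnj a z)\<close> with \<open>\<bar>c\<bar> = 1\<close>. If it is not
  a rotation, its fixed points are the two zeros of a quadratic, and their product has modulus
  \<open>1\<close>. So a single boundary fixed point \<open>w\<close> is a double zero. In the coordinate \<open>u = 1 / (z - w)\<close>, which sends \<open>w\<close> to infinity and the disc to a
  half plane, the map is then a translation \<open>u \<mapsto> u - k\<close> parallel to the boundary of that half
  plane (\<open>parabolic_translation\<close>). Since \<open>1 - \<bar>z\<bar>\<^sup>2\<close> equals the distance of \<open>u\<close> to that
  boundary divided by \<open>\<bar>u\<bar>\<^sup>2\<close>, up to a constant factor, it decays along an orbit like
  \<open>1 / m\<^sup>2\<close>.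

  Invariance. Such a map preserves the expression \<open>(p - w) / (1 - cnj p w)\<close> up to a factor that
  depends on \<open>p\<close> only. So the Blaschke factor at \<open>\<phi> p\<close>, composed with \<open>\<phi>\<close>, is a constant times
  the factor at \<open>p\<close>. Along the orbit of \<open>z\<close> this shifts the factors by one place and gives
  \<open>B \<circ> \<phi> = C (b \<circ> \<phi>) B\<close>, where \<open>b\<close> is the factor at \<open>z\<close> itself and \<open>C\<close> is a constant
  (\<open>blaschke_product_orbit_compose\<close>). For \<open>f = B h\<close> it follows that
  \<open>f \<circ> \<phi> = B (C (b \<circ> \<phi>) (h \<circ> \<phi>))\<close>. Here \<open>b \<circ> \<phi>\<close> is bounded, so it remains to know that
  composition with a holomorphic self-map preserves the Hardy space (\<open>Hardy2_compose\<close>). This is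
  Littlewood's subordination principle: \<open>\<bar>h\<bar>\<^sup>2\<close> lies below the Poisson integral of its
  values on a circle, and that integral is harmonic, so after composition with the self-map its
  mean over a circle is its value at the centre.
\<close>

section \<open>Means over circles and the Poisson kernel\<close>

lemma Re_of_real_mult: "Re (of_real a * z) = a * Re z"
  by simp

text \<open>
  The Cauchy formula in the parametrisation in which the Hardy space means are stated.
\<close>

lemma Cauchy_integral_circle:
  fixes f :: "complex \<Rightarrow> complex"
  assumes contf: "continuous_on (cball 0 r) f" and holf: "f holomorphic_on ball 0 r"
    and w: "norm w < r"
  shows "((\<lambda>t. f (of_real r * exp (\<i> * of_real t)) * (of_real r * exp (\<i> * of_real t))
            / (of_real r * exp (\<i> * of_real t) - w)) has_integral 2 * pi * f w) {0..2 * pi}"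
proof -
  have "((\<lambda>u. f u / (u - w)) has_contour_integral (2 * of_real pi * \<i> * f w))
          (part_circlepath 0 r 0 (2 * pi))"
    using Cauchy_integral_circlepath[OF contf holf] w by (simp add: circlepath_def)
  then have "((\<lambda>t. f (of_real r * cis t) / (of_real r * cis t - w) * r * \<i> * cis t)
               has_integral (2 * of_real pi * \<i> * f w)) {0..2 * pi}"
    by (subst (asm) has_contour_integral_part_circlepath_iff) auto
  then have "((\<lambda>t. (- \<i>) * (f (of_real r * cis t) / (of_real r * cis t - w) * r * \<i> * cis t))
               has_integral (- \<i>) * (2 * of_real pi * \<i> * f w)) {0..2 * pi}"
    by (rule has_integral_mult_right)
  then show ?thesis
    by (simp add: cis_conv_exp mult_ac)
qed

lemma mean_value_circle:
  fixes f :: "complex \<Rightarrow> complex"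
  assumes "continuous_on (cball 0 r) f" "f holomorphic_on ball 0 r" "0 \<le> r"
  shows "((\<lambda>t. f (of_real r * exp (\<i> * of_real t))) has_integral 2 * pi * f 0) {0..2 * pi}"
proof (cases "r = 0")
  case True
  then show ?thesis
    using has_integral_const_real[of "f 0" 0 "2 * pi"] by (simp add: scaleR_conv_of_real)
next
  case False
  then show ?thesis
    using Cauchy_integral_circle[of r f 0] assms by simp
qed

text \<open>
  The Poisson kernel at \<open>w\<close> of the circle through \<open>\<zeta>\<close> centred at \<open>0\<close>. Written as a real part it
  is visibly harmonic in \<open>w\<close>; the usual form is \<open>poisson_kernel_eq\<close>.
\<close>

definition poisson_kernel :: "complex \<Rightarrow> complex \<Rightarrow> real" where
  "poisson_kernel w \<zeta> = Re ((\<zeta> + w) / (\<zeta> - w))"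

lemma poisson_kernel_eq:
  assumes "norm w < norm \<zeta>"
  shows "poisson_kernel w \<zeta> = ((norm \<zeta>)\<^sup>2 - (norm w)\<^sup>2) / (norm (\<zeta> - w))\<^sup>2"
proof -
  have "Re ((\<zeta> + w) * cnj (\<zeta> - w)) = (norm \<zeta>)\<^sup>2 - (norm w)\<^sup>2"
    unfolding cmod_power2 by (simp add: algebra_simps power2_eq_square)
  then show ?thesis
    by (simp add: poisson_kernel_def complex_div_cnj[of "\<zeta> + w" "\<zeta> - w"] 
        flip: of_real_power)
qed

lemma poisson_kernel_le:
  assumes "norm w < norm \<zeta>"
  shows "poisson_kernel w \<zeta> \<le> (norm \<zeta> + norm w) / (norm \<zeta> - norm w)"
proof -
  have "poisson_kernel w \<zeta> \<le> norm ((\<zeta> + w) / (\<zeta> - w))"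
    unfolding poisson_kernel_def by (rule complex_Re_le_cmod)
  also have "\<dots> \<le> (norm \<zeta> + norm w) / (norm \<zeta> - norm w)"
    unfolding norm_divide
    using assms by (intro frac_le norm_triangle_ineq norm_triangle_ineq2) auto
  finally show ?thesis .
qed

text \<open>
  The function \<open>\<bar>f\<bar>\<^sup>2\<close> lies below its Poisson integral because the Cauchy formula can be given
  the Poisson kernel as the modulus of its weight: multiply \<open>f\<^sup>2\<close> by
  \<open>(R\<^sup>2 - \<bar>w\<bar>\<^sup>2) / (R\<^sup>2 - cnj w z)\<close>, which is holomorphic and equals \<open>1\<close> at \<open>z = w\<close>.
\<close>

lemma poisson_majorant:
  assumes holf: "f holomorphic_on ball 0 1" and R: "norm w < R" "R < 1"
  shows "2 * pi * (norm (f w))\<^sup>2 \<le> integral {0..2 * pi}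
           (\<lambda>t. (norm (f (of_real R * exp (\<i> * of_real t))))\<^sup>2
                  * poisson_kernel w (of_real R * exp (\<i> * of_real t)))"
proof -
  define c where "c t = of_real R * exp (\<i> * of_real t)" for t
  have nc: "norm (c t) = R" for t
    using R norm_ge_zero[of w] unfolding c_def norm_mult by (simp del: norm_ge_zero)
  have cc: "continuous_on S c" for S
    unfolding c_def by (intro continuous_intros)
  have contf: "continuous_on (ball 0 1) f"
    using holf by (rule holomorphic_on_imp_continuous_on)
  have Rpos: "0 < R" using R norm_ge_zero[of w] by linarith
  define F where "F z = (f z)\<^sup>2 * (of_real (R\<^sup>2 - (norm w)\<^sup>2) / (of_real (R\<^sup>2) - cnj w * z))" for z
  have nz: "of_real (R\<^sup>2) - cnj w * z \<noteq> 0" if "norm z \<le> R" for z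
  proof -
    have "norm (cnj w * z) \<le> norm w * R"
      using that by (simp add: norm_mult mult_left_mono)
    also have "\<dots> < R\<^sup>2"
      using R(1) Rpos by (simp add: power2_eq_square)
    finally have "norm (cnj w * z) < R\<^sup>2" .
    then show ?thesis
      by (metis abs_of_nonneg eq_iff_diff_eq_0 less_irrefl norm_of_real zero_le_power2)
  qed
  have holF: "F holomorphic_on cball 0 R"
    unfolding F_def using R nz
    by (intro holomorphic_intros holomorphic_on_subset[OF holf]) auto
  have "((\<lambda>t. F (c t) * c t / (c t - w)) has_integral 2 * pi * F w) {0..2 * pi}"
    using Cauchy_integral_circle[of R F w] holomorphic_on_imp_continuous_on[OF holF]
      holomorphic_on_subset[OF holF ball_subset_cball] R(1) by (simp add: c_def)
  moreover have "F w = (f w)\<^sup>2"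
    using nz[of w] R by (simp add: F_def complex_norm_square[symmetric] mult.commute flip: of_real_power)
  ultimately have int: "((\<lambda>t. F (c t) * c t / (c t - w)) has_integral 2 * pi * (f w)\<^sup>2) {0..2 * pi}"
    by simp
  have eq: "norm (F (c t) * c t / (c t - w)) = (norm (f (c t)))\<^sup>2 * poisson_kernel w (c t)" for t
  proof -
    \<comment> \<open>On the circle both denominators have the modulus of \<open>\<zeta> - w\<close>, up to the factor \<open>R\<close>.\<close>
    have "of_real (R\<^sup>2) - cnj w * c t = cnj (c t - w) * c t"
      using complex_norm_square[of "c t"] by (simp add: nc algebra_simps)
    then have "norm (of_real (R\<^sup>2) - cnj w * c t) = norm (c t - w) * R"
      by (simp add: norm_mult nc del: complex_cnj_diff)
    moreover have "\<bar>R\<^sup>2 - (norm w)\<^sup>2\<bar> = R\<^sup>2 - (norm w)\<^sup>2"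
      using R power_mono[of "norm w" R 2] by simp
    moreover have "norm (complex_of_real (R\<^sup>2 - (norm w)\<^sup>2)) = R\<^sup>2 - (norm w)\<^sup>2"
      using calculation(2) by (metis norm_of_real)
    ultimately show ?thesis
      using R Rpos by (simp add: F_def norm_mult norm_divide nc poisson_kernel_eq norm_power power2_eq_square
         del: of_real_diff)
  qed
  have "norm (2 * pi * (f w)\<^sup>2) \<le> integral {0..2 * pi} (\<lambda>t. norm (F (c t) * c t / (c t - w)))"
  proof -
    have ci: "(\<lambda>t. norm (F (c t) * c t / (c t - w))) integrable_on {0..2 * pi}"
    proof (intro integrable_continuous_interval continuous_intros cc)
      show "continuous_on {0..2 * pi} (\<lambda>t. F (c t))"
        by (rule continuous_on_compose2[OF holomorphic_on_imp_continuous_on[OF holF] cc]) (simp add: nc image_subset_iff)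
      show "\<forall>t\<in>{0..2 * pi}. c t - w \<noteq> 0"
        using R nc by (metis eq_iff_diff_eq_0 less_irrefl)
    qed
    show ?thesis
      using integral_norm_bound_integral[OF has_integral_integrable[OF int] ci] int
      by (simp add: integral_unique)
  qed
  then show ?thesis
    unfolding eq by (simp add: c_def norm_mult norm_power)
qed

lemma poisson_kernel_compose_mean:
  assumes hol: "\<phi> holomorphic_on ball 0 1" and r: "0 \<le> r" "r < 1"
    and less: "\<And>z. norm z \<le> r \<Longrightarrow> norm (\<phi> z) < norm \<zeta>"
  shows "integral {0..2 * pi} (\<lambda>t. poisson_kernel (\<phi> (of_real r * exp (\<i> * of_real t))) \<zeta>)
           = 2 * pi * poisson_kernel (\<phi> 0) \<zeta>"
proof -
  have "(\<lambda>z. (\<zeta> + \<phi> z) / (\<zeta> - \<phi> z)) holomorphic_on cball 0 r"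
    using r less by (intro holomorphic_intros holomorphic_on_subset[OF hol]) force+
  then have "((\<lambda>t. (\<zeta> + \<phi> (of_real r * exp (\<i> * of_real t))) / (\<zeta> - \<phi> (of_real r * exp (\<i> * of_real t))))
        has_integral 2 * pi * ((\<zeta> + \<phi> 0) / (\<zeta> - \<phi> 0))) {0..2 * pi}"
    using mean_value_circle[of r "\<lambda>z. (\<zeta> + \<phi> z) / (\<zeta> - \<phi> z)"] r(1) holomorphic_on_imp_continuous_on
      holomorphic_on_subset[OF _ ball_subset_cball] by auto
  from has_integral_Re[OF this] show ?thesis
    unfolding poisson_kernel_def mult.assoc of_real_mult[symmetric] Re_of_real_mult
    by (rule integral_unique)
qed

text \<open>
  Bound \<open>\<bar>f\<bar>\<^sup>2\<close> at \<open>\<phi> z\<close> by its Poisson integral over the circle of radius \<open>R\<close> and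
  exchange the two integrals: the mean over \<open>\<bar>z\<bar> = r\<close> then only meets the kernel, and replaces its
  argument \<open>\<phi> z\<close> by \<open>\<phi> 0\<close>.
\<close>

lemma subordination_circle:
  assumes holf: "f holomorphic_on ball 0 1" and hol: "\<phi> holomorphic_on ball 0 1"
    and r: "0 \<le> r" "r < 1" and R: "R < 1"
    and less: "\<And>z. norm z \<le> r \<Longrightarrow> norm (\<phi> z) < R"
  shows "integral {0..2 * pi} (\<lambda>t. (norm (f (\<phi> (of_real r * exp (\<i> * of_real t)))))\<^sup>2)
       \<le> (R + norm (\<phi> 0)) / (R - norm (\<phi> 0))
          * integral {0..2 * pi} (\<lambda>t. (norm (f (of_real R * exp (\<i> * of_real t))))\<^sup>2)"
proof -
  define c where "c r t = of_real r * exp (\<i> * of_real t)" for r t :: real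
  have R0: "0 < R" using less[of 0] r by (simp add: le_less_trans[OF norm_ge_zero])
  have nc: "norm (c r t) = r" "norm (c R t) = R" for t
    using r R0 by (simp_all add: c_def norm_mult)
  have cc[continuous_intros]: "continuous_on S (\<lambda>x. c q (g x))" if "continuous_on S g" for S q and g :: "'b::topological_space \<Rightarrow> real"
    unfolding c_def by (intro continuous_intros that)
  have lessc: "norm (\<phi> (c r t)) < R" for t
    using less[of "c r t"] by (simp add: nc)
  have nez: "c R s - \<phi> (c r t) \<noteq> 0" for s t
    using lessc[of t] nc(2)[of s] by auto
  have cf: "continuous_on S (\<lambda>x. f (c R (g x)))" if "continuous_on S g" for S and g :: "'b::topological_space \<Rightarrow> real"
    by (rule continuous_on_compose2[OF holomorphic_on_imp_continuous_on[OF holf]])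
       (use R in \<open>auto intro!: continuous_intros that simp: nc\<close>)
  have cphi: "continuous_on S (\<lambda>x. \<phi> (c r (g x)))" if "continuous_on S g" for S and g :: "'b::topological_space \<Rightarrow> real"
    by (rule continuous_on_compose2[OF holomorphic_on_imp_continuous_on[OF hol]])
       (use r in \<open>auto intro!: continuous_intros that simp: nc\<close>)
  have cfphi: "continuous_on S (\<lambda>x. f (\<phi> (c r x)))" for S
    by (rule continuous_on_compose2[OF holomorphic_on_imp_continuous_on[OF holf] cphi])
       (use R in \<open>auto intro!: continuous_intros less_trans[OF lessc]\<close>)
  define K where "K t s = (norm (f (c R s)))\<^sup>2 * poisson_kernel (\<phi> (c r t)) (c R s)" for t s
  have contK: "continuous_on S (\<lambda>(t, s). K t s)" for S
    unfolding K_def poisson_kernel_def split_beta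
    by (intro continuous_intros cf cphi) (use nez in auto)
  have contK1: "continuous_on S (K t)" for t S
    using continuous_on_compose2[OF contK[of UNIV] continuous_on_Pair[OF continuous_on_const[of S t] continuous_on_id]] by simp
  have "2 * pi * integral {0..2 * pi} (\<lambda>t. (norm (f (\<phi> (c r t))))\<^sup>2)
      = integral {0..2 * pi} (\<lambda>t. 2 * pi * (norm (f (\<phi> (c r t))))\<^sup>2)"
    by simp
  also have "\<dots> \<le> integral {0..2 * pi} (\<lambda>t. integral {0..2 * pi} (K t))"
  proof (rule integral_le)
    show "(\<lambda>t. 2 * pi * (norm (f (\<phi> (c r t))))\<^sup>2) integrable_on {0..2 * pi}"
      by (intro integrable_continuous_interval continuous_intros cfphi)
    show "(\<lambda>t. integral {0..2 * pi} (K t)) integrable_on {0..2 * pi}"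
      using integral_continuous_on_param[of "{0..2 * pi}" 0 "2 * pi" K] contK
      by (intro integrable_continuous_interval) (auto simp: split_def)
    show "2 * pi * (norm (f (\<phi> (c r t))))\<^sup>2 \<le> integral {0..2 * pi} (K t)" for t
      unfolding K_def using poisson_majorant[OF holf lessc R] by (simp add: c_def)
  qed
  also have "\<dots> = integral {0..2 * pi} (\<lambda>s. integral {0..2 * pi} (\<lambda>t. K t s))"
    using integral_swap_continuous[of 0 0 "2 * pi" "2 * pi" K] contK by (simp add: cbox_interval)
  also have "\<dots> = integral {0..2 * pi} (\<lambda>s. 2 * pi * ((norm (f (c R s)))\<^sup>2 * poisson_kernel (\<phi> 0) (c R s)))"
  proof (rule integral_cong)
    fix s
    have "integral {0..2 * pi} (\<lambda>t. poisson_kernel (\<phi> (c r t)) (c R s)) = 2 * pi * poisson_kernel (\<phi> 0) (c R s)"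
      unfolding c_def[of r] by (rule poisson_kernel_compose_mean[OF hol r]) (simp add: nc less)
    then show "integral {0..2 * pi} (\<lambda>t. K t s) = 2 * pi * ((norm (f (c R s)))\<^sup>2 * poisson_kernel (\<phi> 0) (c R s))"
      by (simp add: K_def)
  qed
  also have "\<dots> \<le> integral {0..2 * pi} (\<lambda>s. 2 * pi * ((norm (f (c R s)))\<^sup>2 * ((R + norm (\<phi> 0)) / (R - norm (\<phi> 0)))))"
  proof (rule integral_le)
    have 0: "norm (\<phi> 0) < norm (c R s)" for s using less[of 0] r by (simp add: nc)
    show "(\<lambda>s. 2 * pi * ((norm (f (c R s)))\<^sup>2 * poisson_kernel (\<phi> 0) (c R s))) integrable_on {0..2 * pi}"
      unfolding poisson_kernel_def
      by (intro integrable_continuous_interval continuous_intros cf) (use 0 in \<open>metis eq_iff_diff_eq_0 less_irrefl\<close>)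
    show "(\<lambda>s. 2 * pi * ((norm (f (c R s)))\<^sup>2 * ((R + norm (\<phi> 0)) / (R - norm (\<phi> 0))))) integrable_on {0..2 * pi}"
      by (intro integrable_continuous_interval continuous_on_mult continuous_on_const continuous_on_power continuous_on_norm cf continuous_on_id)
    show "2 * pi * ((norm (f (c R s)))\<^sup>2 * poisson_kernel (\<phi> 0) (c R s))
        \<le> 2 * pi * ((norm (f (c R s)))\<^sup>2 * ((R + norm (\<phi> 0)) / (R - norm (\<phi> 0))))" for s
      using poisson_kernel_le[OF 0[of s]] by (intro mult_left_mono) (auto simp: nc)
  qed
  also have "\<dots> = 2 * pi * ((R + norm (\<phi> 0)) / (R - norm (\<phi> 0)) * integral {0..2 * pi} (\<lambda>s. (norm (f (c R s)))\<^sup>2))"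
    by simp
  finally show ?thesis
    unfolding c_def by (rule mult_left_le_imp_le) simp
qed

section \<open>Composition and multiplication in the Hardy space\<close>

lemma Hardy2_bound:
  assumes "h \<in> Hardy2"
  obtains M where "\<And>R. 0 \<le> R \<Longrightarrow> R < 1 \<Longrightarrow>
      1 / (2 * pi) * integral {0..2 * pi} (\<lambda>t. (norm (h (of_real R * exp (\<i> * of_real t))))\<^sup>2) \<le> M"
proof -
  from assms obtain M where "\<And>x. x \<in> (\<lambda>r::real. 1 / (2 * pi) *
        integral {0..2 * pi} (\<lambda>t. (norm (h (of_real r * exp (\<i> * of_real t))))\<^sup>2)) ` {0..<1} \<Longrightarrow> x \<le> M"
    unfolding Hardy2_def bdd_above_def by blast
  then show ?thesis
    by (intro that[of M]) (meson imageI atLeastLessThan_iff)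
qed

text \<open>
  Littlewood's subordination principle. The circles of radius \<open>R\<close> close to \<open>1\<close> give the bound for
  every \<open>r\<close>, and the constant in \<open>subordination_circle\<close> stays bounded as \<open>R\<close> tends to \<open>1\<close>.
\<close>

lemma Hardy2_compose:
  assumes h: "h \<in> Hardy2" and hol: "\<phi> holomorphic_on ball 0 1" and self: "\<phi> ` ball 0 1 \<subseteq> ball 0 1"
  shows "h \<circ> \<phi> \<in> Hardy2"
proof -
  have holh: "h holomorphic_on ball 0 1" using h by (simp add: Hardy2_def)
  obtain M where M: "\<And>R. 0 \<le> R \<Longrightarrow> R < 1 \<Longrightarrow>
      1 / (2 * pi) * integral {0..2 * pi} (\<lambda>t. (norm (h (of_real R * exp (\<i> * of_real t))))\<^sup>2) \<le> M"
    using Hardy2_bound[OF h] by blast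
  define b where "b = norm (\<phi> 0)"
  have b1: "b < 1" using self by (force simp: b_def)
  have b0: "0 \<le> b" by (simp add: b_def)
  have "1 / (2 * pi) * integral {0..2 * pi} (\<lambda>t. (norm ((h \<circ> \<phi>) (of_real r * exp (\<i> * of_real t))))\<^sup>2) \<le> 4 / (1 - b) * M"
    if r: "0 \<le> r" "r < 1" for r
  proof -
    have "continuous_on (cball 0 r) (\<lambda>z. norm (\<phi> z))"
      using r by (intro continuous_intros holomorphic_on_imp_continuous_on holomorphic_on_subset[OF hol]) auto
    moreover have "cball 0 r \<noteq> ({} :: complex set)" using r by simp
    ultimately obtain x where x: "x \<in> cball 0 r" "\<And>z. z \<in> cball 0 r \<Longrightarrow> norm (\<phi> z) \<le> norm (\<phi> x)"
      using continuous_attains_sup[of "cball 0 r" "\<lambda>z. norm (\<phi> z)"] by auto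
    \<comment> \<open>\<open>R\<close> must exceed \<open>\<bar>\<phi>\<bar>\<close> on the circle, and stay away from \<open>b\<close> to bound the factor uniformly in \<open>r\<close>.\<close>
    have "max (norm (\<phi> x)) ((1 + b) / 2) < 1"
      using self x r b1 by force
    then obtain R where R: "max (norm (\<phi> x)) ((1 + b) / 2) < R" "R < 1"
      using dense by blast
    have less: "norm (\<phi> z) < R" if "norm z \<le> r" for z
      using x(2)[of z] that R by auto
    let ?I = "integral {0..2 * pi} (\<lambda>t. (norm (h (of_real R * exp (\<i> * of_real t))))\<^sup>2)"
    have I0: "0 \<le> ?I"
      by (cases "(\<lambda>t. (norm (h (of_real R * exp (\<i> * of_real t))))\<^sup>2) integrable_on {0..2 * pi}")
         (auto intro: has_integral_nonneg[OF integrable_integral] simp: not_integrable_integral)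
    have R2: "(R + b) / (R - b) \<le> 4 / (1 - b)"
    proof -
      have "(R + b) / (R - b) \<le> 2 / ((1 - b) / 2)"
        using R b1 b0 by (intro frac_le) (auto simp: field_simps)
      then show ?thesis by simp
    qed
    have "1 / (2 * pi) * integral {0..2 * pi} (\<lambda>t. (norm ((h \<circ> \<phi>) (of_real r * exp (\<i> * of_real t))))\<^sup>2)
       \<le> 1 / (2 * pi) * ((R + b) / (R - b) * ?I)"
      unfolding o_def b_def
      by (intro mult_left_mono subordination_circle holh hol r R(2) less) auto
    also have "\<dots> \<le> 1 / (2 * pi) * (4 / (1 - b) * ?I)"
      by (intro mult_left_mono mult_right_mono R2 I0) auto
    also have "\<dots> = 4 / (1 - b) * (1 / (2 * pi) * ?I)"
      by simp
    also have "\<dots> \<le> 4 / (1 - b) * M"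
      using R b1 b0 by (intro mult_left_mono M) auto
    finally show ?thesis .
  qed
  moreover have "h \<circ> \<phi> holomorphic_on ball 0 1"
    using holomorphic_on_compose_gen[OF hol holh self] .
  ultimately show ?thesis
    unfolding Hardy2_def by (auto intro!: bdd_aboveI2)
qed

lemma Hardy2_bounded_mult:
  assumes h: "h \<in> Hardy2" and hol: "g holomorphic_on ball 0 1"
    and bound: "\<And>z. norm z < 1 \<Longrightarrow> norm (g z) \<le> K"
  shows "(\<lambda>z. g z * h z) \<in> Hardy2"
proof -
  have holh: "h holomorphic_on ball 0 1" using h by (simp add: Hardy2_def)
  obtain M where M: "\<And>R. 0 \<le> R \<Longrightarrow> R < 1 \<Longrightarrow>
      1 / (2 * pi) * integral {0..2 * pi} (\<lambda>t. (norm (h (of_real R * exp (\<i> * of_real t))))\<^sup>2) \<le> M"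
    using Hardy2_bound[OF h] by blast
  have "1 / (2 * pi) * integral {0..2 * pi} (\<lambda>t. (norm (g (of_real r * exp (\<i> * of_real t)) * h (of_real r * exp (\<i> * of_real t))))\<^sup>2) \<le> K\<^sup>2 * M"
    if r: "0 \<le> r" "r < 1" for r
  proof -
    define c where "c t = of_real r * exp (\<i> * of_real t)" for t :: real
    have nc: "norm (c t) < 1" for t using r by (simp add: c_def norm_mult)
    have cont: "continuous_on S (\<lambda>t. f (c t))" if "f holomorphic_on ball 0 1" for f and S
      by (rule continuous_on_compose2[OF holomorphic_on_imp_continuous_on[OF that]])
         (auto simp: nc, auto simp: c_def intro!: continuous_intros)
    have "integral {0..2 * pi} (\<lambda>t. (norm (g (c t) * h (c t)))\<^sup>2) \<le> integral {0..2 * pi} (\<lambda>t. K\<^sup>2 * (norm (h (c t)))\<^sup>2)"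
    proof (rule integral_le)
      show "(norm (g (c t) * h (c t)))\<^sup>2 \<le> K\<^sup>2 * (norm (h (c t)))\<^sup>2" for t
        using bound[OF nc[of t]] by (simp add: norm_mult power_mult_distrib mult_right_mono power_mono)
    qed (intro integrable_continuous_interval continuous_intros cont hol holh)+
    also have "\<dots> = K\<^sup>2 * integral {0..2 * pi} (\<lambda>t. (norm (h (c t)))\<^sup>2)"
      by simp
    finally have "1 / (2 * pi) * integral {0..2 * pi} (\<lambda>t. (norm (g (c t) * h (c t)))\<^sup>2)
       \<le> K\<^sup>2 * (1 / (2 * pi) * integral {0..2 * pi} (\<lambda>t. (norm (h (c t)))\<^sup>2))"
      by (simp add: field_simps)
    also have "\<dots> \<le> K\<^sup>2 * M"
      unfolding c_def by (intro mult_left_mono M r) auto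
    finally show ?thesis by (simp add: c_def)
  qed
  then show ?thesis
    using hol holh unfolding Hardy2_def by (auto intro!: bdd_aboveI2 holomorphic_intros)
qed

section \<open>Automorphisms of the disc\<close>

lemma one_minus_cnj_mult_nonzero:
  fixes a z :: complex
  assumes "norm a < 1" "norm z \<le> 1"
  shows "1 - cnj a * z \<noteq> 0"
proof
  assume "1 - cnj a * z = 0"
  then have "norm (cnj a * z) = 1" by simp
  moreover have "norm a * norm z \<le> norm a * 1"
    using assms(2) by (intro mult_left_mono) auto
  ultimately show False
    using assms(1) by (simp add: norm_mult)
qed

text \<open>
  Precomposing with a Moebius map makes \<open>0\<close> a fixed point. The Schwarz lemma for the resulting
  map and for its inverse shows that it preserves the modulus, so it is a rotation.
\<close>

lemma disc_automorphism_Moebius: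
  assumes "disc_automorphism \<phi>"
  obtains c a where "norm c = 1" "norm a < 1"
    "\<And>z. norm z < 1 \<Longrightarrow> \<phi> z = c * ((z - a) / (1 - cnj a * z))"
proof -
  have hol: "\<phi> holomorphic_on ball 0 1" and bij: "bij_betw \<phi> (ball 0 1) (ball 0 1)"
    using assms by (auto simp: disc_automorphism_def)
  have img: "\<phi> ` ball 0 1 = ball 0 1" and inj: "inj_on \<phi> (ball 0 1)"
    using bij by (auto simp: bij_betw_def)
  obtain a where a: "norm a < 1" "\<phi> a = 0"
    using img by (metis centre_in_ball imageE mem_ball_0 zero_less_one)
  obtain \<phi>' where hol': "\<phi>' holomorphic_on \<phi> ` ball 0 1" and inv: "\<And>z. z \<in> ball 0 1 \<Longrightarrow> \<phi>' (\<phi> z) = z"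
    using holomorphic_has_inverse[OF hol open_ball inj] by metis
  have maps: "norm (\<phi> z) < 1" "norm (\<phi>' z) < 1" if "norm z < 1" for z
  proof -
    show "norm (\<phi> z) < 1" using img that by (metis imageI mem_ball_0)
    from that have "z \<in> \<phi> ` ball 0 1" using img by simp
    then show "norm (\<phi>' z) < 1" using inv by auto
  qed
  define M where "M = Moebius_function 0 a"
  define M' where "M' = Moebius_function 0 (- a)"
  have Mh: "M holomorphic_on ball 0 1" "M' holomorphic_on ball 0 1"
    using a by (simp_all add: M_def M'_def Moebius_function_holomorphic)
  have Mn: "norm (M z) < 1" "norm (M' z) < 1" if "norm z < 1" for z
    using a that by (simp_all add: M_def M'_def Moebius_function_norm_lt_1)
  have MM: "M (M' z) = z" "M' (M z) = z" if "norm z < 1" for z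
    using a that by (simp_all add: M_def M'_def Moebius_function_compose)
  define g where "g = \<phi> \<circ> M'"
  define k where "k = M \<circ> \<phi>'"
  have g: "g holomorphic_on ball 0 1" "g 0 = 0" "\<And>z. norm z < 1 \<Longrightarrow> norm (g z) < 1"
    unfolding g_def using a maps Mn
    by (auto intro!: holomorphic_on_compose_gen[OF Mh(2) hol]) (simp add: M'_def Moebius_function_simple)
  have kg: "k (g z) = z" if "norm z < 1" for z
    using that by (simp add: k_def g_def inv Mn MM)
  have k: "k holomorphic_on ball 0 1" "k 0 = 0" "\<And>z. norm z < 1 \<Longrightarrow> norm (k z) < 1"
    using kg[of 0] g(2) maps Mn hol' img
    by (auto simp: k_def intro!: holomorphic_on_compose_gen[OF _ Mh(1)])
  have "norm (g z) = norm z" if "norm z < 1" for z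
    using Schwarz_Lemma(1)[OF g that] Schwarz_Lemma(1)[OF k g(3)[OF that]] kg[OF that] by simp
  from this[of "1/2"] have "\<exists>z. norm z < 1 \<and> z \<noteq> 0 \<and> norm (g z) = norm z"
    by (intro exI[of _ "1/2"]) (simp add: norm_divide)
  then obtain c where c: "\<And>z. norm z < 1 \<Longrightarrow> g z = c * z" "norm c = 1"
    using Schwarz_Lemma(3)[OF g, of 0] by auto
  show thesis
  proof (rule that[OF c(2) a(1)])
    fix z :: complex assume z: "norm z < 1"
    have "\<phi> z = g (M z)" using MM(2)[OF z] by (simp add: g_def)
    also have "\<dots> = c * M z" using c(1) Mn(1)[OF z] .
    finally show "\<phi> z = c * ((z - a) / (1 - cnj a * z))"
      by (simp add: M_def Moebius_function_simple)
  qed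
qed

text \<open>
  The two equations say that \<open>w\<close> is a double zero of \<open>cnj a z\<^sup>2 + (c - 1) z - c a\<close>, whose zeros
  are the fixed points.
\<close>

lemma parabolic_normal_form:
  assumes "parabolic_automorphism \<phi>"
  obtains c a w where "norm c = 1" "norm a < 1" "a \<noteq> 0" "norm w = 1"
    "c = 1 - 2 * cnj a * w" "c * a = - cnj a * w\<^sup>2"
    "\<And>z. norm z < 1 \<Longrightarrow> \<phi> z = c * ((z - a) / (1 - cnj a * z))"
proof -
  have aut: "disc_automorphism \<phi>"
    using assms by (simp add: parabolic_automorphism_def)
  obtain \<psi> where cont: "continuous_on (cball 0 1) \<psi>"
    and ext: "\<forall>z\<in>ball 0 1. \<psi> z = \<phi> z"
    and ex1: "\<exists>!w. w \<in> sphere 0 1 \<and> \<psi> w = w"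
    using assms unfolding parabolic_automorphism_def by (elim conjE exE)
  obtain c a where c: "norm c = 1" and a: "norm a < 1"
    and form: "\<And>z. norm z < 1 \<Longrightarrow> \<phi> z = c * ((z - a) / (1 - cnj a * z))"
    by (rule disc_automorphism_Moebius[OF aut]) (rule that)
  have nz: "1 - cnj a * z \<noteq> 0" if "norm z \<le> 1" for z
    using one_minus_cnj_mult_nonzero[OF a that] .
  have psi: "\<psi> z = c * ((z - a) / (1 - cnj a * z))" if "norm z \<le> 1" for z
  proof -
    have "continuous_on (closure (ball 0 1)) (\<lambda>z. \<psi> z - c * ((z - a) / (1 - cnj a * z)))"
      using nz cont by (auto intro!: continuous_intros)
    moreover have "\<psi> x - c * ((x - a) / (1 - cnj a * x)) = 0" if "x \<in> ball 0 1" for x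
      using that ext form by simp
    moreover have "z \<in> closure (ball 0 1)"
      using that by simp
    ultimately have "\<psi> z - c * ((z - a) / (1 - cnj a * z)) = 0"
      by (rule continuous_constant_on_closure)
    then show ?thesis by simp
  qed
  have fix_iff: "\<psi> z = z \<longleftrightarrow> cnj a * z\<^sup>2 + (c - 1) * z - c * a = 0" if "norm z = 1" for z
    using nz[of z] that
    by (simp add: psi field_simps power2_eq_square)
  from ex1 obtain w where w': "w \<in> sphere 0 1 \<and> \<psi> w = w"
    and uniq': "\<forall>v. v \<in> sphere 0 1 \<and> \<psi> v = v \<longrightarrow> v = w"
    by (rule ex1E) (rule that)
  have w: "norm w = 1" "\<psi> w = w" using w' by simp_all
  have uniq: "v = w" if "norm v = 1" "\<psi> v = v" for v
    using uniq'[rule_format, of v] that by simp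
  have w0: "w \<noteq> 0" and c0: "c \<noteq> 0" using w c by auto
  have eqw: "cnj a * w\<^sup>2 + (c - 1) * w - c * a = 0"
    using fix_iff w by simp
  have a0: "a \<noteq> 0"
  proof
    assume "a = 0"
    then have "c = 1" using eqw w0 by simp
    then have "- w = w"
      using \<open>a = 0\<close> w by (intro uniq) (auto simp: psi)
    then show False using w0 by simp
  qed
  \<comment> \<open>The other zero of the quadratic; it lies on the circle too, because \<open>\<bar>c\<bar> = 1\<close>.\<close>
  define v where "v = - (c * a) / (cnj a * w)"
  have cw: "cnj a * w * v = - (c * a)"
    using a0 w0 by (simp add: v_def)
  have "norm v = 1"
    using c a0 w by (simp add: v_def norm_mult norm_divide)
  moreover have "cnj a * v\<^sup>2 + (c - 1) * v - c * a = 0"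
  proof -
    have "(cnj a * w) * w * (cnj a * v\<^sup>2 + (c - 1) * v - c * a)
        = (cnj a * w * v)\<^sup>2 + (c - 1) * w * (cnj a * w * v) - c * a * (cnj a * w\<^sup>2)"
      by (simp add: algebra_simps power2_eq_square)
    also have "\<dots> = - (c * a) * (cnj a * w\<^sup>2 + (c - 1) * w - c * a)"
      unfolding cw by (simp add: algebra_simps power2_eq_square)
    finally show ?thesis using eqw a0 w0 by simp
  qed
  ultimately have "v = w"
    using uniq[of v] fix_iff[of v] by simp
  then have ca: "c * a = - cnj a * w\<^sup>2"
    using cw by (simp add: power2_eq_square algebra_simps)
  have "w * (2 * cnj a * w + c - 1) = 0"
    using eqw ca by (simp add: algebra_simps power2_eq_square)
  then have "2 * cnj a * w + c - 1 = 0"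
    using w0 by (simp only: mult_eq_0_iff simp_thms)
  then have "c = 1 - 2 * cnj a * w"
    by (simp add: algebra_simps)
  then show thesis
    using that[OF c a a0 w(1) _ ca form] by simp
qed

text \<open>
  Since \<open>w\<close> is a double fixed point, the map becomes a translation when \<open>w\<close> is moved to infinity.
  The condition \<open>Re (w k) = 0\<close> holds because the map preserves the circle, which becomes the line
  \<open>Re (w u) = - 1 / 2\<close>; in the proof it comes from \<open>\<bar>c\<bar> = 1\<close>, where \<open>c = 1 - 2 cnj a w\<close>.
\<close>

lemma parabolic_translation:
  assumes "parabolic_automorphism \<phi>"
  obtains w k where "norm w = 1" "k \<noteq> 0" "Re (w * k) = 0"
    "\<And>z. norm z < 1 \<Longrightarrow> 1 / (\<phi> z - w) = 1 / (z - w) - k"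
proof -
  obtain c a w where c: "norm c = 1" and a: "norm a < 1" "a \<noteq> 0" and w: "norm w = 1"
    and ceq: "c = 1 - 2 * cnj a * w" and ca: "c * a = - cnj a * w\<^sup>2"
    and form: "\<And>z. norm z < 1 \<Longrightarrow> \<phi> z = c * ((z - a) / (1 - cnj a * z))"
    by (rule parabolic_normal_form[OF assms]) (rule that)
  define s where "s = cnj a * w"
  have s1: "1 - s \<noteq> 0"
    using one_minus_cnj_mult_nonzero[of a w] a w by (simp add: s_def)
  define k where "k = cnj a / (1 - s)"
  show thesis
  proof (rule that[OF w])
    show "k \<noteq> 0" using a s1 by (simp add: k_def)
    have "(norm (1 - 2 * s))\<^sup>2 = 1"
      using c by (simp add: ceq s_def mult.assoc)
    then have "Re s = (norm s)\<^sup>2"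
      unfolding cmod_power2 by (simp add: power2_eq_square algebra_simps)
    then have "Re (s * cnj (1 - s)) = 0"
      unfolding cmod_power2 by (simp add: power2_eq_square algebra_simps)
    moreover have "w * k = s * cnj (1 - s) / of_real ((norm (1 - s))\<^sup>2)"
      using complex_div_cnj[of s "1 - s"] by (simp add: k_def s_def mult.commute)
    ultimately show "Re (w * k) = 0"
      by (simp only: Re_divide_of_real div_0)
    fix z :: complex assume z: "norm z < 1"
    have nz: "1 - cnj a * z \<noteq> 0" "z - w \<noteq> 0"
      using one_minus_cnj_mult_nonzero[of a z] a z w by auto
    have "\<phi> z - w = (c * z - c * a - w * (1 - cnj a * z)) / (1 - cnj a * z)"
      using nz by (simp add: form[OF z] field_simps)
    also have "c * z - c * a - w * (1 - cnj a * z) = (1 - s) * (z - w)"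
      unfolding ca unfolding ceq s_def by (simp add: algebra_simps power2_eq_square)
    finally have "1 / (\<phi> z - w) = (1 - cnj a * z) / ((1 - s) * (z - w))"
      by simp
    also have "1 - cnj a * z = (1 - s) - cnj a * (z - w)"
      by (simp add: s_def algebra_simps)
    also have "\<dots> / ((1 - s) * (z - w)) = 1 / (z - w) - k"
    proof -
      have "1 / (z - w) = (1 - s) / ((1 - s) * (z - w))" and "k = cnj a * (z - w) / ((1 - s) * (z - w))"
        using s1 nz by (simp_all add: k_def)
      then show ?thesis by (simp only: diff_divide_distrib)
    qed
    finally show "1 / (\<phi> z - w) = 1 / (z - w) - k" .
  qed
qed

section \<open>Orbits of parabolic automorphisms\<close>

lemma summable_inverse_square_arithmetic:
  fixes u k :: complex
  assumes "k \<noteq> 0"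
  shows "summable (\<lambda>m. 1 / (norm (u - of_nat m * k))\<^sup>2)"
proof (rule summable_comparison_test_ev)
  \<comment> \<open>From then on the term \<open>m k\<close> is at least twice as long as \<open>u\<close>.\<close>
  have "\<forall>\<^sub>F m in sequentially. 2 * norm u / norm k < real m"
    by real_asymp
  then show "\<forall>\<^sub>F m in sequentially. norm (1 / (norm (u - of_nat m * k))\<^sup>2) \<le> 4 / (norm k)\<^sup>2 * inverse (real m ^ 2)"
  proof eventually_elim
    case (elim m)
    then have m: "2 * norm u < real m * norm k"
      using assms by (simp add: field_simps)
    then have pos: "0 < real m * norm k / 2"
      using norm_ge_zero[of u] by linarith
    have "real m * norm k \<le> norm u + norm (u - of_nat m * k)"
      using norm_triangle_sub[of "of_nat m * k" u] by (simp add: norm_mult norm_minus_commute)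
    then have "real m * norm k / 2 \<le> norm (u - of_nat m * k)"
      using m by simp
    then have "1 / (norm (u - of_nat m * k))\<^sup>2 \<le> 1 / (real m * norm k / 2)\<^sup>2"
      using pos by (intro frac_le power_mono zero_less_power) auto
    then show ?case
      by (simp add: field_simps power2_eq_square)
  qed
  show "summable (\<lambda>m. 4 / (norm k)\<^sup>2 * inverse (real m ^ 2))"
    by (intro summable_mult inverse_power_summable) simp
qed

lemma disc_automorphism_norm_less:
  assumes "disc_automorphism \<phi>" "norm z < 1"
  shows "norm (\<phi> z) < 1"
  using assms unfolding disc_automorphism_def bij_betw_def by (metis imageI mem_ball_0)

lemma disc_automorphism_funpow_norm_less:
  assumes "disc_automorphism \<phi>" "norm z < 1"
  shows "norm ((\<phi> ^^ m) z) < 1"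
  by (induction m) (simp_all add: assms disc_automorphism_norm_less)

text \<open>
  In the half plane coordinate \<open>u = 1 / (v - w)\<close> the factor \<open>- (1 + 2 Re (w u))\<close> measures the
  distance to the boundary; a translation parallel to the boundary does not change it.
\<close>

lemma one_minus_norm_sq_Cayley:
  assumes w: "norm w = 1" and v: "v \<noteq> w"
  shows "1 - (norm v)\<^sup>2 = - (1 + 2 * Re (w * (1 / (v - w)))) * (1 / (norm (1 / (v - w)))\<^sup>2)"
proof -
  define u where "u = 1 / (v - w)"
  have u: "u \<noteq> 0" "u * v = w * u + 1" using v by (auto simp: u_def field_simps)
  have "(norm u)\<^sup>2 * (norm v)\<^sup>2 = (norm (w * u + 1))\<^sup>2"
    using u(2) by (metis norm_mult power_mult_distrib)
  also have "\<dots> = (norm (w * u))\<^sup>2 + 2 * Re (w * u) + 1"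
    unfolding cmod_power2 by (simp add: power2_eq_square algebra_simps)
  also have "(norm (w * u))\<^sup>2 = (norm u)\<^sup>2"
    by (simp add: norm_mult w)
  finally have "(norm u)\<^sup>2 * (1 - (norm v)\<^sup>2) = - (1 + 2 * Re (w * u))"
    by (simp add: algebra_simps)
  then show ?thesis
    using u(1) unfolding u_def[symmetric] by (simp add: field_simps)
qed

text \<open>
  Along the orbit \<open>u\<close> runs through an arithmetic progression at constant height, so
  \<open>1 - \<bar>\<phi>\<^sub>m z\<bar>\<^sup>2\<close> is a constant times an inverse square.
\<close>

lemma parabolic_orbit_Blaschke_summable:
  assumes par: "parabolic_automorphism \<phi>" and z: "norm z < 1"
  shows "summable (\<lambda>m. 1 - norm ((\<phi> ^^ m) z))"
proof -
  have aut: "disc_automorphism \<phi>" using par by (simp add: parabolic_automorphism_def)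
  obtain w k where w: "norm w = 1" and k: "k \<noteq> 0" "Re (w * k) = 0"
    and step: "\<And>z. norm z < 1 \<Longrightarrow> 1 / (\<phi> z - w) = 1 / (z - w) - k"
    by (rule parabolic_translation[OF par]) (rule that)
  define u where "u = 1 / (z - w)"
  have less: "norm ((\<phi> ^^ m) z) < 1" for m
    using disc_automorphism_funpow_norm_less[OF aut z] .
  have orbit: "1 / ((\<phi> ^^ m) z - w) = u - of_nat m * k" for m
    by (induction m) (simp_all add: u_def step less algebra_simps)
  have "1 - (norm ((\<phi> ^^ m) z))\<^sup>2 = - (1 + 2 * Re (w * u)) * (1 / (norm (u - of_nat m * k))\<^sup>2)" for m
  proof -
    have "(\<phi> ^^ m) z \<noteq> w" using less[of m] w by auto
    moreover have "Re (w * (u - of_nat m * k)) = Re (w * u)"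
    proof -
      have "w * (u - of_nat m * k) = w * u - of_real (real m) * (w * k)"
        by (simp add: algebra_simps)
      also have "Re \<dots> = Re (w * u) - real m * Re (w * k)"
        by (simp only: minus_complex.sel Re_of_real_mult)
      finally show ?thesis using k(2) by simp
    qed
    ultimately show ?thesis
      using one_minus_norm_sq_Cayley[OF w, of "(\<phi> ^^ m) z"] unfolding orbit by simp
  qed
  then have "summable (\<lambda>m. 1 - (norm ((\<phi> ^^ m) z))\<^sup>2)"
    by (simp only:) (intro summable_mult summable_inverse_square_arithmetic k)
  then show ?thesis
  proof (rule summable_comparison_test')
    fix m :: nat
    have "(norm ((\<phi> ^^ m) z))\<^sup>2 \<le> norm ((\<phi> ^^ m) z)"
      using less[of m] by (simp add: power2_eq_square mult_left_le)
    then show "norm (1 - norm ((\<phi> ^^ m) z)) \<le> 1 - (norm ((\<phi> ^^ m) z))\<^sup>2"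
      using less[of m] by simp
  qed
qed

section \<open>Blaschke products along an orbit\<close>

text \<open>
  The unimodular normalisation of a Blaschke factor. The value \<open>-1\<close> at \<open>0\<close> makes the formula
  \<open>blaschke_factor_eq\<close> valid for \<open>a = 0\<close> too.
\<close>

definition blaschke_unit :: "complex \<Rightarrow> complex" where
  "blaschke_unit a = (if a = 0 then -1 else of_real (norm a) / a)"

lemma norm_blaschke_unit [simp]: "norm (blaschke_unit a) = 1"
  by (simp add: blaschke_unit_def norm_divide)

lemma blaschke_factor_eq: "blaschke_factor a z = blaschke_unit a * ((a - z) / (1 - cnj a * z))"
  by (simp add: blaschke_factor_def blaschke_unit_def)

lemma norm_one_minus_cnj_mult_ge:
  fixes a z :: complex
  assumes "norm a \<le> 1"
  shows "1 - norm z \<le> norm (1 - cnj a * z)"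
proof -
  have "norm (cnj a * z) \<le> 1 * norm z"
    using assms by (simp only: norm_mult complex_mod_cnj mult_right_mono norm_ge_zero)
  then show ?thesis
    using norm_triangle_ineq2[of 1 "cnj a * z"] by simp
qed

text \<open>
  Because of the normalisation the numerator of \<open>b - 1\<close>, where \<open>b\<close> is the factor, is divisible by
  \<open>1 - \<bar>a\<bar>\<close>. This makes the product converge absolutely.
\<close>

lemma norm_blaschke_factor_diff_1_le:
  assumes a: "norm a < 1" and z: "norm z < 1"
  shows "norm (blaschke_factor a z - 1) \<le> 2 / (1 - norm z) * (1 - norm a)"
proof (cases "a = 0")
  case True
  have "norm (z - 1) \<le> 2"
    using norm_triangle_ineq4[of z 1] z by simp
  also have "\<dots> \<le> 2 / (1 - norm z)"
    using z by (simp add: field_simps)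
  finally show ?thesis
    using True by (simp add: blaschke_factor_def)
next
  case False
  have nz: "1 - cnj a * z \<noteq> 0"
    using one_minus_cnj_mult_nonzero a z by simp
  have aa: "a * cnj a = of_real (norm a) * of_real (norm a)"
    using complex_norm_square[of a] by (simp add: power2_eq_square)
  have "blaschke_factor a z - 1 = (of_real (norm a) * (a - z) - (a - a * cnj a * z)) / (a * (1 - cnj a * z))"
    using False nz by (simp add: blaschke_factor_def field_simps)
  also have "\<dots> = - of_real (1 - norm a) * (a + of_real (norm a) * z) / (a * (1 - cnj a * z))"
    unfolding aa by (simp add: algebra_simps)
  finally have "norm (blaschke_factor a z - 1)
      = (1 - norm a) * norm (a + of_real (norm a) * z) / (norm a * norm (1 - cnj a * z))"
    using a by (simp add: norm_mult norm_divide del: of_real_diff)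
  also have "\<dots> \<le> (1 - norm a) * (norm a * 2) / (norm a * (1 - norm z))"
  proof (intro frac_le mult_left_mono)
    have "norm (a + of_real (norm a) * z) \<le> norm a + norm a * norm z"
      using norm_triangle_ineq[of a "of_real (norm a) * z"] by (simp add: norm_mult)
    also have "\<dots> \<le> norm a * 2"
      using z by (simp add: mult_left_le)
    finally show "norm (a + of_real (norm a) * z) \<le> norm a * 2" .
    show "1 - norm z \<le> norm (1 - cnj a * z)"
      using a by (intro norm_one_minus_cnj_mult_ge) simp
  qed (use a z False in auto)
  also have "\<dots> = 2 / (1 - norm z) * (1 - norm a)"
    using False by simp
  finally show ?thesis .
qed

lemma convergent_prod_blaschke_factor:
  assumes a: "\<And>m. norm (a m) < 1" and sum: "summable (\<lambda>m. 1 - norm (a m))" and z: "norm z < 1"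
  shows "convergent_prod (\<lambda>m. blaschke_factor (a m) z)"
proof (intro abs_convergent_prod_imp_convergent_prod summable_imp_abs_convergent_prod)
  show "summable (\<lambda>m. norm (blaschke_factor (a m) z - 1))"
    by (rule summable_comparison_test'[OF summable_mult[OF sum, of "2 / (1 - norm z)"]])
       (simp add: norm_blaschke_factor_diff_1_le a z del: times_divide_eq_left)
qed

lemma blaschke_product_eq_0:
  assumes "\<And>m. norm (a m) < 1" "summable (\<lambda>m. 1 - norm (a m))" "norm z < 1"
    and "blaschke_factor (a m) z = 0"
  shows "blaschke_product a z = 0"
  unfolding blaschke_product_def
  using convergent_prod_has_prod[OF convergent_prod_blaschke_factor[OF assms(1-3)]] assms(4)
  by (rule has_prod_zeroI)

text \<open>
  Invariance of the pseudo-hyperbolic distance, with the phase kept. What matters is that \<open>q\<close>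
  does not depend on \<open>w\<close>.
\<close>

lemma blaschke_factor_automorphism:
  assumes aut: "disc_automorphism \<phi>" and p: "norm p < 1"
  obtains q where "\<And>w. norm w < 1 \<Longrightarrow> blaschke_factor (\<phi> p) (\<phi> w) = q * blaschke_factor p w"
proof -
  obtain c a where c: "norm c = 1" and a: "norm a < 1"
    and form: "\<And>z. norm z < 1 \<Longrightarrow> \<phi> z = c * ((z - a) / (1 - cnj a * z))"
    by (rule disc_automorphism_Moebius[OF aut]) (rule that)
  have cc: "cnj c * c = 1"
    using c complex_norm_square[of c] by (simp add: mult.commute)
  have d: "1 - cnj a * a \<noteq> 0"
    using one_minus_cnj_mult_nonzero[OF a] a by simp
  define \<tau> where "\<tau> = c * (1 - a * cnj p) / (1 - cnj a * p)"
  have pseudo: "(\<phi> p - \<phi> w) / (1 - cnj (\<phi> p) * \<phi> w) = \<tau> * ((p - w) / (1 - cnj p * w))"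
    if w: "norm w < 1" for w
  proof -
    define A where "A = 1 - cnj a * p"
    define B where "B = 1 - cnj a * w"
    define E where "E = 1 - a * cnj p"
    have E: "E = cnj A" by (simp add: A_def E_def)
    have nz: "A \<noteq> 0" "B \<noteq> 0"
      using one_minus_cnj_mult_nonzero[OF a, of p] one_minus_cnj_mult_nonzero[OF a, of w] p w
      by (simp_all add: A_def B_def)
    then have nzE: "E \<noteq> 0" by (simp add: E)
    have 1: "\<phi> p - \<phi> w = c * ((1 - cnj a * a) * (p - w)) / (A * B)"
    proof -
      have "(p - a) * B - (w - a) * A = (1 - cnj a * a) * (p - w)"
        by (simp add: A_def B_def algebra_simps)
      moreover have "\<phi> p - \<phi> w = c * ((p - a) * B - (w - a) * A) / (A * B)"
        unfolding form[OF p] form[OF w] A_def[symmetric] B_def[symmetric]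
        using nz by (simp add: field_simps)
      ultimately show ?thesis by simp
    qed
    have 2: "1 - cnj (\<phi> p) * \<phi> w = (1 - cnj a * a) * (1 - cnj p * w) / (E * B)"
    proof -
      have "cnj (\<phi> p) * \<phi> w = (cnj c * c) * ((cnj p - cnj a) * (w - a)) / (E * B)"
        unfolding form[OF p] form[OF w] A_def[symmetric] B_def[symmetric] E
        by simp
      then have "1 - cnj (\<phi> p) * \<phi> w = (E * B - (cnj p - cnj a) * (w - a)) / (E * B)"
        unfolding cc using nz nzE by (simp add: diff_divide_distrib)
      also have "E * B - (cnj p - cnj a) * (w - a) = (1 - cnj a * a) * (1 - cnj p * w)"
        by (simp add: E_def B_def algebra_simps)
      finally show ?thesis .
    qed
    have cancel: "(c * (d * e) / (A * B)) / (d * f / (E * B)) = c * E / A * (e / f)"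
      if "d \<noteq> 0" "f \<noteq> 0" for d e f
      using nz nzE that by (simp add: field_simps)
    have "1 - cnj p * w \<noteq> 0"
      using one_minus_cnj_mult_nonzero[OF p, of w] w by simp
    from cancel[OF d this] show ?thesis
      unfolding 1 2 \<tau>_def A_def[symmetric] E_def[symmetric] .
  qed
  show thesis
  proof (rule that)
    fix w :: complex assume w: "norm w < 1"
    have "blaschke_unit p \<noteq> 0" by (metis norm_blaschke_unit norm_zero zero_neq_one)
    then show "blaschke_factor (\<phi> p) (\<phi> w)
        = (blaschke_unit (\<phi> p) * \<tau> / blaschke_unit p) * blaschke_factor p w"
      unfolding blaschke_factor_eq pseudo[OF w] by simp
  qed
qed

text \<open>
  Composition with \<open>\<phi>\<close> turns the factor at the point \<open>m + 1\<close> of the orbit into a constant \<open>q m\<close>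
  times the factor at the point \<open>m\<close>; only the first factor has no partner. The product of the
  constants converges because, at a point \<open>w\<close> outside the orbit, it is a quotient of two convergent
  products with nonzero factors.
\<close>

lemma blaschke_product_orbit_compose:
  assumes aut: "disc_automorphism \<phi>" and z: "norm z < 1"
    and sum: "summable (\<lambda>m. 1 - norm ((\<phi> ^^ m) z))"
  obtains C where "\<And>w. norm w < 1 \<Longrightarrow>
    blaschke_product (\<lambda>m. (\<phi> ^^ m) z) (\<phi> w)
      = C * blaschke_factor z (\<phi> w) * blaschke_product (\<lambda>m. (\<phi> ^^ m) z) w"
proof -
  define a where "a = (\<lambda>m. (\<phi> ^^ m) z)"
  have a: "norm (a m) < 1" for m
    using disc_automorphism_funpow_norm_less[OF aut z] by (simp add: a_def)
  have a_Suc: "a (Suc m) = \<phi> (a m)" for m by (simp add: a_def)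
  have suma: "summable (\<lambda>m. 1 - norm (a m))" using sum by (simp add: a_def)
  have "\<forall>m. \<exists>q. \<forall>w. norm w < 1 \<longrightarrow> blaschke_factor (\<phi> (a m)) (\<phi> w) = q * blaschke_factor (a m) w"
  proof
    fix m
    obtain q where "\<And>w. norm w < 1 \<Longrightarrow> blaschke_factor (\<phi> (a m)) (\<phi> w) = q * blaschke_factor (a m) w"
      by (rule blaschke_factor_automorphism[OF aut a]) (rule that)
    then show "\<exists>q. \<forall>w. norm w < 1 \<longrightarrow> blaschke_factor (\<phi> (a m)) (\<phi> w) = q * blaschke_factor (a m) w"
      by blast
  qed
  then obtain q where q: "\<And>m w. norm w < 1 \<Longrightarrow>
      blaschke_factor (a (Suc m)) (\<phi> w) = q m * blaschke_factor (a m) w"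
    unfolding a_Suc by metis
  have "blaschke_product a (\<phi> w) = prodinf q * blaschke_factor (a 0) (\<phi> w) * blaschke_product a w"
    if w: "norm w < 1" for w
  proof -
    have pw: "norm (\<phi> w) < 1" using disc_automorphism_norm_less[OF aut w] .
    note cw = convergent_prod_blaschke_factor[OF a suma w]
    note cpw = convergent_prod_blaschke_factor[OF a suma pw]
    show ?thesis
    \<comment> \<open>At a point of the orbit both sides vanish.\<close>
    proof (cases "\<exists>m. blaschke_factor (a m) w = 0")
      case True
      then obtain m where m: "blaschke_factor (a m) w = 0" ..
      have "blaschke_product a w = 0"
        using blaschke_product_eq_0[OF a suma w m] .
      moreover have "blaschke_product a (\<phi> w) = 0"
        using blaschke_product_eq_0[OF a suma pw, of "Suc m"] q[OF w, of m] m by simp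
      ultimately show ?thesis by simp
    next
      case False
      have "convergent_prod (\<lambda>m. blaschke_factor (a (Suc m)) (\<phi> w) / blaschke_factor (a m) w)"
        using cw cpw by (intro convergent_prod_divide) (simp_all only: convergent_prod_Suc_iff[of "\<lambda>m. blaschke_factor (a m) (\<phi> w)"])
      then have cq: "convergent_prod q"
        using False by (simp add: q[OF w])
      have "blaschke_product a (\<phi> w)
          = blaschke_factor (a 0) (\<phi> w) * (\<Prod>m. blaschke_factor (a (Suc m)) (\<phi> w))"
      proof (cases "blaschke_factor (a 0) (\<phi> w) = 0")
        case True
        then show ?thesis using blaschke_product_eq_0[OF a suma pw] by simp
      next
        case False
        then show ?thesis
          using prodinf_split_head[OF cpw] by (simp add: blaschke_product_def)
      qed
      also have "(\<Prod>m. blaschke_factor (a (Suc m)) (\<phi> w)) = prodinf q * blaschke_product a w"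
        unfolding q[OF w] blaschke_product_def using prodinf_mult[OF cq cw] by simp
      finally show ?thesis by simp
    qed
  qed
  from this[unfolded a_def funpow_0] show thesis
    by (rule that)
qed

lemma norm_blaschke_factor_le:
  assumes a: "norm a < 1" and z: "norm z < 1"
  shows "norm (blaschke_factor a z) \<le> 2 / (1 - norm a)"
proof -
  have "norm (1 - cnj a * z) \<ge> 1 - norm a"
    using norm_one_minus_cnj_mult_ge[of "cnj z" "cnj a"] z by (simp add: mult.commute)
  moreover have "norm (a - z) \<le> 2"
    using norm_triangle_ineq4[of a z] a z by simp
  ultimately show ?thesis
    using a by (simp add: blaschke_factor_eq norm_mult norm_divide frac_le)
qed

lemma blaschke_factor_holomorphic:
  assumes a: "norm a < 1"
  shows "blaschke_factor a holomorphic_on ball 0 1"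
  unfolding blaschke_factor_eq[abs_def]
  by (intro holomorphic_intros) (use one_minus_cnj_mult_nonzero[OF a] in auto)

section \<open>Summable orbits and invariant subspaces\<close>

theorem theorem4p1:
  fixes \<phi> :: "complex \<Rightarrow> complex"
  assumes "parabolic_automorphism \<phi>"
  shows "(\<forall>z\<in>ball 0 1. summable (\<lambda>m. 1 - norm ((\<phi> ^^ m) z))) \<and>
         (\<forall>z\<in>ball 0 1.
            composition_operator \<phi> ` times_Hardy2 (blaschke_product (\<lambda>m. (\<phi> ^^ m) z))
              \<subseteq> times_Hardy2 (blaschke_product (\<lambda>m. (\<phi> ^^ m) z)))"
proof (intro conjI ballI image_subsetI)
  fix z :: complex assume "z \<in> ball 0 1"
  then show "summable (\<lambda>m. 1 - norm ((\<phi> ^^ m) z))"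
    using parabolic_orbit_Blaschke_summable[OF assms] by simp
next
  fix z :: complex and f
  assume "z \<in> ball 0 1" and f: "f \<in> times_Hardy2 (blaschke_product (\<lambda>m. (\<phi> ^^ m) z))"
  then have z: "norm z < 1" by simp
  have aut: "disc_automorphism \<phi>"
    using assms by (simp add: parabolic_automorphism_def)
  then have hol: "\<phi> holomorphic_on ball 0 1" and self: "\<phi> ` ball 0 1 \<subseteq> ball 0 1"
    by (auto simp: disc_automorphism_def bij_betw_def)
  obtain h where h: "h \<in> Hardy2"
    and fh: "\<And>w. norm w < 1 \<Longrightarrow> f w = blaschke_product (\<lambda>m. (\<phi> ^^ m) z) w * h w"
    using f by (auto simp: times_Hardy2_def)
  obtain C where C: "\<And>w. norm w < 1 \<Longrightarrow>
      blaschke_product (\<lambda>m. (\<phi> ^^ m) z) (\<phi> w)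
        = C * blaschke_factor z (\<phi> w) * blaschke_product (\<lambda>m. (\<phi> ^^ m) z) w"
    by (rule blaschke_product_orbit_compose[OF aut z parabolic_orbit_Blaschke_summable[OF assms z]]) (rule that)
  define g where "g w = C * blaschke_factor z (\<phi> w)" for w
  have "(\<lambda>w. g w * (h \<circ> \<phi>) w) \<in> Hardy2"
  proof (rule Hardy2_bounded_mult[OF Hardy2_compose[OF h hol self]])
    show "g holomorphic_on ball 0 1"
      unfolding g_def
      using holomorphic_on_compose_gen[OF hol blaschke_factor_holomorphic[OF z] self]
      by (intro holomorphic_intros) (simp add: o_def)
    show "norm (g w) \<le> norm C * (2 / (1 - norm z))" if "norm w < 1" for w
      unfolding g_def norm_mult
      by (intro mult_left_mono norm_blaschke_factor_le z disc_automorphism_norm_less[OF aut that]) simp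
  qed
  moreover have "composition_operator \<phi> f w
      = blaschke_product (\<lambda>m. (\<phi> ^^ m) z) w * (g w * (h \<circ> \<phi>) w)" if "w \<in> ball 0 1" for w
    using that disc_automorphism_norm_less[OF aut, of w]
    by (simp add: composition_operator_def fh C g_def)
  ultimately show "composition_operator \<phi> f \<in> times_Hardy2 (blaschke_product (\<lambda>m. (\<phi> ^^ m) z))"
    unfolding times_Hardy2_def mem_Collect_eq by (intro bexI ballI)
qed

end
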